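(* Let $G$ be the generator of a continuous-time ergodic birth-and-death chain on $\{0, \dots, d\}$ with stationary probability mass function $\pi$, and let $\nu_0\ge \nu_1 \ge \dots \ge \nu_{d - 1} > \nu_d = 0$ be the eigenvalues of $-G$. For $k=0,\dots,d$ define $$Q_k := \nu_0^{-1} \cdots \nu_{k - 1}^{-1} (G + \nu_0 I) \cdots (G + \nu_{k-1} I),\qquad Q_0:=I.$$ Then the matrices $Q_k$, $0\le k\le d$, are all stochastic, and every row of $Q_d$ equals $\pi$.
   Context: A continuous-time birth-and-death chain on $\{0,\dots,d\}$ has a tridiagonal generator; ergodic means irreducible. Eigenvalues are listed with multiplicity. $I$ is the identity matrix. A square matrix is stochastic if its entries are nonnegative and each row sums to $1$. *)

theory Defs
  imports "Jordan_Normal_Form.Char_Poly"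
begin

text \<open>
  Chains on \<open>{0..d}\<close> have generators of dimension \<open>Suc d\<close>; matrix indices start at 0, so
  index \<open>i\<close> is state \<open>i\<close>.
\<close>

definition generator :: "nat \<Rightarrow> real mat \<Rightarrow> bool" where
  "generator n G \<longleftrightarrow> G \<in> carrier_mat n n
     \<and> (\<forall>i<n. \<forall>j<n. i \<noteq> j \<longrightarrow> 0 \<le> G $$ (i, j))
     \<and> (\<forall>i<n. (\<Sum>j<n. G $$ (i, j)) = 0)"

definition tridiagonal :: "real mat \<Rightarrow> bool" where
  "tridiagonal A \<longleftrightarrow>
     (\<forall>i<dim_row A. \<forall>j<dim_col A. i + 1 < j \<or> j + 1 < i \<longrightarrow> A $$ (i, j) = 0)"

definition birth_death_generator :: "nat \<Rightarrow> real mat \<Rightarrow> bool" where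
  "birth_death_generator d G \<longleftrightarrow> generator (Suc d) G \<and> tridiagonal G"

definition irreducible_generator :: "real mat \<Rightarrow> bool" where
  "irreducible_generator G \<longleftrightarrow>
     (\<forall>i<dim_row G. \<forall>j<dim_row G.
        (i, j) \<in> {(k, l). k < dim_row G \<and> l < dim_row G \<and> k \<noteq> l \<and> 0 < G $$ (k, l)}\<^sup>*)"

definition pmf_vec :: "nat \<Rightarrow> real vec \<Rightarrow> bool" where
  "pmf_vec n p \<longleftrightarrow> p \<in> carrier_vec n \<and> (\<forall>i<n. 0 \<le> p $ i) \<and> (\<Sum>i<n. p $ i) = 1"

text \<open>The row-vector equation \<open>p G = 0\<close> is written with the transpose.\<close>

definition stationary_pmf :: "real mat \<Rightarrow> real vec \<Rightarrow> bool" where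
  "stationary_pmf G p \<longleftrightarrow>
     pmf_vec (dim_row G) p \<and> transpose_mat G *\<^sub>v p = 0\<^sub>v (dim_row G)"

definition stochastic_mat :: "nat \<Rightarrow> real mat \<Rightarrow> bool" where
  "stochastic_mat n P \<longleftrightarrow> P \<in> carrier_mat n n
     \<and> (\<forall>i<n. \<forall>j<n. 0 \<le> P $$ (i, j))
     \<and> (\<forall>i<n. (\<Sum>j<n. P $$ (i, j)) = 1)"

text \<open>
  \<open>\<nu> 0, \<dots>, \<nu> (n - 1)\<close> are the eigenvalues of \<open>A\<close>, repeated according to their
  (algebraic) multiplicity.
\<close>

definition eigenvalues_with_mult :: "nat \<Rightarrow> real mat \<Rightarrow> (nat \<Rightarrow> real) \<Rightarrow> bool" where
  "eigenvalues_with_mult n A \<nu> \<longleftrightarrow>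
     A \<in> carrier_mat n n \<and> char_poly A = (\<Prod>i<n. [:- \<nu> i, 1:])"

primrec shifted_prod :: "real mat \<Rightarrow> (nat \<Rightarrow> real) \<Rightarrow> nat \<Rightarrow> real mat" where
  "shifted_prod G \<nu> 0 = 1\<^sub>m (dim_row G)"
| "shifted_prod G \<nu> (Suc k) = shifted_prod G \<nu> k * (G + \<nu> k \<cdot>\<^sub>m 1\<^sub>m (dim_row G))"

definition Q_mat :: "real mat \<Rightarrow> (nat \<Rightarrow> real) \<Rightarrow> nat \<Rightarrow> real mat" where
  "Q_mat G \<nu> k = (\<Prod>i<k. inverse (\<nu> i)) \<cdot>\<^sub>m shifted_prod G \<nu> k"

end

theory Submission
  imports Defs
begin

text \<open>
  For \<open>i \<le> j\<close> the \<open>(i, j)\<close> entry of the adjugate of \<open>t - G\<close> is a positive constant times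
  \<open>H\<^sub>i(t) T\<^sub>j(t)\<close>, where \<open>H\<^sub>i\<close> and \<open>T\<^sub>j\<close> are the characteristic polynomials of the blocks of
  \<open>G\<close> before \<open>i\<close> and after \<open>j\<close>; the case \<open>i > j\<close> is symmetric. Expanding the identity
  \<open>adj(t - G) (t - G) = \<chi>(t) I\<close> in a Newton basis shows that \<open>(G + \<nu>\<^sub>0) \<cdots> (G + \<nu>\<^sub>k\<^sub>-\<^sub>1)\<close> is
  the divided difference of \<open>adj(t - G)\<close> at the largest eigenvalues \<open>-\<nu>\<^sub>d, \<dots>, -\<nu>\<^sub>k\<close> of \<open>G\<close>.
  By interlacing, the \<open>l\<close>-th largest root of \<open>H\<^sub>i T\<^sub>j\<close> is at most the \<open>l\<close>-th largest eigenvalue,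
  and this makes the divided difference nonnegative. Finally \<open>Q\<^sub>d G = 0\<close>, and the left kernel
  of \<open>G\<close> is one-dimensional.
\<close>

hide_const (open) Module.smult

subsection \<open>Divided differences\<close>

text \<open>Newton's divided difference. Synthetic division forms (p - p(x)) / (X - x) without
  dividing scalars, so nodes may repeat. The value 0 on the empty list lets the Leibniz rules below
  hold for a single node.\<close>

fun div_diff :: "'a::comm_ring_1 poly \<Rightarrow> 'a list \<Rightarrow> 'a" where
  "div_diff p [] = 0"
| "div_diff p [x] = poly p x"
| "div_diff p (x # y # ys) = div_diff (synthetic_div p x) (y # ys)"

lemma synthetic_div_add:
  "synthetic_div (p + q) c = synthetic_div p c + synthetic_div q c"
proof -
  let ?p = "synthetic_div p c" and ?q = "synthetic_div q c"
  have "p + q + smult c (?p + ?q) = (p + smult c ?p) + (q + smult c ?q)"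
    by (simp only: smult_add_right ac_simps)
  also have "\<dots> = pCons (poly p c + poly q c) (?p + ?q)"
    by (simp only: synthetic_div_correct add_pCons)
  finally show ?thesis by (metis synthetic_div_unique)
qed

lemma synthetic_div_smult:
  fixes p :: "'a::comm_ring_1 poly"
  shows "synthetic_div (smult a p) c = smult a (synthetic_div p c)"
proof -
  let ?p = "synthetic_div p c"
  have "smult a p + smult c (smult a ?p) = smult a (p + smult c ?p)"
    by (simp add: smult_add_right mult.commute)
  also have "\<dots> = pCons (a * poly p c) (smult a ?p)"
    by (simp only: synthetic_div_correct smult_pCons)
  finally show ?thesis by (metis synthetic_div_unique)
qed

lemma synthetic_div_linear_mult:
  fixes p :: "'a::comm_ring_1 poly"
  shows "synthetic_div ([:- m, 1:] * p) c = [:- m, 1:] * synthetic_div p c + [:poly p c:]"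
proof -
  have "synthetic_div ([:- m, 1:] * p) c
      = synthetic_div (smult (- m) p + pCons 0 p) c" by simp
  also have "\<dots> = smult (- m) (synthetic_div p c) + pCons (poly p c) (synthetic_div p c)"
    by (simp only: synthetic_div_add synthetic_div_smult synthetic_div_pCons)
  finally show ?thesis by simp
qed

lemma div_diff_add: "div_diff (p + q) xs = div_diff p xs + div_diff q xs"
  by (induction p xs arbitrary: q rule: div_diff.induct) (auto simp: synthetic_div_add)

lemma div_diff_smult: "div_diff (smult a p) xs = a * div_diff p xs"
  by (induction p xs rule: div_diff.induct) (auto simp: synthetic_div_smult)

lemma div_diff_0 [simp]: "div_diff 0 xs = 0"
  using div_diff_smult[of 0 0 xs] by simp

lemma div_diff_diff: "div_diff (p - q) xs = div_diff p xs - div_diff q xs"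
  using div_diff_add[of "p - q" q xs] by simp

lemma div_diff_sum: "div_diff (\<Sum>i\<in>A. f i) xs = (\<Sum>i\<in>A. div_diff (f i) xs)"
  by (induction A rule: infinite_finite_induct) (auto simp: div_diff_add)

lemma div_diff_const: "div_diff [:c:] xs = (if length xs = 1 then c else 0)"
  by (cases "([:c:], xs)" rule: div_diff.cases) (auto simp: synthetic_div_pCons)

text \<open>Leibniz rule charging the linear factor to the last node; it matches the matrix
  recursion, where one node is dropped at the end. With the companion rule for the first node,
  symmetry in the nodes need not be established.\<close>

lemma div_diff_linear_mult_snoc:
  "div_diff ([:- m, 1:] * p) (xs @ [y]) = (y - m) * div_diff p (xs @ [y]) + div_diff p xs"
proof (induction p xs rule: div_diff.induct)
  case (1 p)
  then show ?case by (simp add: algebra_simps)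
next
  case (2 p x)
  show ?case
    by (simp only: append.simps div_diff.simps synthetic_div_linear_mult)
       (simp add: algebra_simps)
next
  case (3 p x z zs)
  have "div_diff ([:- m, 1:] * p) ((x # z # zs) @ [y])
      = div_diff ([:- m, 1:] * synthetic_div p x + [:poly p x:]) ((z # zs) @ [y])"
    by (simp only: append.simps div_diff.simps synthetic_div_linear_mult)
  also have "\<dots> = div_diff ([:- m, 1:] * synthetic_div p x) ((z # zs) @ [y])"
    by (simp only: div_diff_add div_diff_const) simp
  finally show ?case using 3 by simp
qed

lemma div_diff_linear_mult_Cons:
  "div_diff ([:- m, 1:] * p) (x # xs) = (x - m) * div_diff p (x # xs) + div_diff p xs"
proof (cases xs)
  case Nil
  then show ?thesis by (simp add: algebra_simps)
next
  case (Cons y ys)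
  \<comment> \<open>Write X - m as (x - m) + (X - x) and use p = (X - x) q + p(x) for the quotient
    q.\<close>
  have "[:- m, 1:] * synthetic_div p x + [:poly p x:] = smult (x - m) (synthetic_div p x) + p"
    using synthetic_div_correct'[of x p] by (simp add: algebra_simps smult_diff_left)
  then have "synthetic_div ([:- m, 1:] * p) x = smult (x - m) (synthetic_div p x) + p"
    by (simp only: synthetic_div_linear_mult)
  then show ?thesis
    by (simp only: Cons div_diff.simps div_diff_add div_diff_smult)
qed

section \<open>Divided differences of polynomials given by their roots\<close>

definition root_poly :: "'a::comm_ring_1 multiset \<Rightarrow> 'a poly" where
  "root_poly M = (\<Prod>s\<in>#M. [:- s, 1:])"

lemma root_poly_simps [simp]:
  "root_poly {#} = 1"
  "root_poly (add_mset s M) = [:- s, 1:] * root_poly M"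
  "root_poly (M + N) = root_poly M * root_poly N"
  by (simp_all add: root_poly_def)

text \<open>Each node is also a root, so the factor \<open>x - m\<close> of the Leibniz rule
  vanishes and only the shorter list survives, down to the empty one.\<close>

lemma div_diff_root_poly_self:
  "div_diff (root_poly (mset (xs @ ys))) xs = 0"
proof (induction xs)
  case (Cons x xs)
  have "root_poly (mset ((x # xs) @ ys)) = [:- x, 1:] * root_poly (mset (xs @ ys))"
    by (simp only: append.simps mset.simps root_poly_simps)
  then show ?case using Cons by (simp only: div_diff_linear_mult_Cons) simp
qed simp

lemma div_diff_one: "div_diff 1 xs = (if length xs = 1 then 1 else 0)"
  using div_diff_const[of 1 xs] by (simp add: one_pCons)

text \<open>With more nodes than the degree, only a leading coefficient can remain: each linear
  factor uses up one node, and the term keeping all nodes has too many of them for its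
  degree.\<close>

lemma div_diff_root_poly_degree:
  "size M < length xs \<Longrightarrow>
    div_diff (root_poly M) xs = (if length xs = Suc (size M) then 1 else 0)"
proof (induction M arbitrary: xs)
  case empty
  then show ?case by (simp add: div_diff_one)
next
  case (add m M)
  then obtain x xs' where "xs = x # xs'" by (cases xs) auto
  with add show ?case
    by (simp only: root_poly_simps div_diff_linear_mult_Cons) simp
qed

section \<open>Domination of multisets and the sign of divided differences\<close>

text \<open>Says that the l-th largest element of \<open>M\<close> is at most the l-th largest of
  \<open>N\<close>. Counting above thresholds makes transitivity and additivity immediate.\<close>

definition dominated :: "'a::linorder multiset \<Rightarrow> 'a multiset \<Rightarrow> bool" where
  "dominated M N \<longleftrightarrow> (\<forall>x. size {#y \<in># M. x \<le> y#} \<le> size {#y \<in># N. x \<le> y#})"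

lemma dominated_trans: "dominated A B \<Longrightarrow> dominated B C \<Longrightarrow> dominated A C"
  by (meson dominated_def order_trans)

lemma dominated_refl [simp]: "dominated A A"
  by (simp add: dominated_def)

lemma dominated_add: "dominated A B \<Longrightarrow> dominated C D \<Longrightarrow> dominated (A + C) (B + D)"
  by (simp add: dominated_def add_mono)

lemma dominated_mset_setI:
  assumes "finite A" "finite B" "inj_on f A" "f ` A \<subseteq> B" "\<And>a. a \<in> A \<Longrightarrow> a \<le> f a"
  shows "dominated (mset_set A) (mset_set B)"
  unfolding dominated_def
proof
  fix x
  have "card {y \<in> A. x \<le> y} = card (f ` {y \<in> A. x \<le> y})"
    using assms(3) by (intro card_image[symmetric]) (auto simp: inj_on_def)
  also have "\<dots> \<le> card {y \<in> B. x \<le> y}"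
    using assms by (intro card_mono) (auto dest: order_trans)
  finally show "size {#y \<in># mset_set A. x \<le> y#} \<le> size {#y \<in># mset_set B. x \<le> y#}"
    using assms by simp
qed

text \<open>
  Splitting off the largest root \<open>\<mu>\<close>, the Leibniz rule writes the divided difference as
  \<open>x - \<mu>\<close> times one with the same nodes plus one without the top node \<open>x\<close>;
  domination survives in both.
\<close>

lemma div_diff_root_poly_nonneg:
  fixes M :: "'a::linordered_idom multiset"
  assumes "sorted_wrt (\<ge>) (xs @ ys)" "dominated M (mset (xs @ ys))"
  shows "0 \<le> div_diff (root_poly M) xs"
  using assms
proof (induction "size M" arbitrary: M xs)
  case 0
  then show ?case by (simp add: div_diff_one)
next
  case (Suc k)
  show ?case
  proof (cases xs)
    case (Cons x xs')
    define m where "m = Max_mset M"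
    have mM: "m \<in># M" using Suc.hyps(2) unfolding m_def
      by (metis Max_in finite_set_mset set_mset_eq_empty_iff size_empty nat.distinct(1))
    then obtain M' where M': "M = add_mset m M'" by (metis multi_member_split)
    have le_m: "y \<le> m" if "y \<in># M" for y using that by (simp add: m_def)
    \<comment> \<open>The threshold \<open>m\<close> counts at least one root, hence at least one
      node, so the top node \<open>x\<close> is not below \<open>m\<close>.\<close>
    have "size {#y \<in># M. m \<le> y#} > 0"
      by (simp add: M')
    then have "size {#y \<in># mset (xs @ ys). m \<le> y#} > 0"
      using Suc.prems(2) unfolding dominated_def by (metis gr_zeroI leD)
    then obtain y where "y \<in> set (xs @ ys)" "m \<le> y"
      by (auto simp: nonempty_has_size[symmetric] filter_mset_eq_conv)
    then have mx: "m \<le> x" using Suc.prems(1) Cons by (auto intro: order_trans)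
    have d1: "dominated M' (mset (xs @ ys))"
      using Suc.prems(2) unfolding dominated_def M'
      by (auto simp: split: if_splits dest: Suc_leD)
    \<comment> \<open>For thresholds up to \<open>m\<close> both counts drop by exactly one; above
      \<open>m\<close> no root is left to count.\<close>
    have d2: "dominated M' (mset (xs' @ ys))"
      unfolding dominated_def
    proof
      fix z
      show "size {#y \<in># M'. z \<le> y#} \<le> size {#y \<in># mset (xs' @ ys). z \<le> y#}"
      proof (cases "z \<le> m")
        case True
        then have "z \<le> x" using mx by simp
        with True show ?thesis
          using Suc.prems(2)[unfolded dominated_def, rule_format, of z]
          by (simp add: M' Cons)
      next
        case False
        then have "{#y \<in># M'. z \<le> y#} = {#}"
          using le_m M' by (fastforce simp: filter_mset_eq_conv)
        then show ?thesis by (simp only: size_empty)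
      qed
    qed
    have k: "k = size M'" using Suc.hyps(2) M' by simp
    have "0 \<le> div_diff (root_poly M') xs"
      by (rule Suc.hyps(1)[OF k Suc.prems(1) d1])
    moreover have "0 \<le> div_diff (root_poly M') xs'"
      using Suc.prems(1) by (intro Suc.hyps(1)[OF k _ d2]) (simp add: Cons)
    ultimately show ?thesis using mx
      unfolding M' root_poly_simps Cons div_diff_linear_mult_Cons by simp
  qed simp
qed

subsection \<open>Interlacing roots\<close>

abbreviation set_poly :: "real set \<Rightarrow> real poly" where
  "set_poly S \<equiv> root_poly (mset_set S)"

lemma poly_root_poly: "poly (root_poly M) x = (\<Prod>s\<in>#M. x - s)"
  by (induction M) (auto simp: algebra_simps)

lemma poly_set_poly_eq_0_iff: "finite S \<Longrightarrow> poly (set_poly S) x = 0 \<longleftrightarrow> x \<in> S"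
  by (auto simp: poly_root_poly prod_unfold_prod_mset[symmetric])

lemma root_poly_nonzero [simp]: "root_poly (M :: real multiset) \<noteq> 0"
  by (induction M) (auto simp del: mult_pCons_left)

lemma degree_root_poly [simp]: "degree (root_poly (M :: real multiset)) = size M"
  by (induction M) (auto simp: degree_mult_eq simp del: mult_pCons_left)

lemma lead_coeff_root_poly: "lead_coeff (root_poly (M :: real multiset)) = 1"
  by (induction M) (auto simp: lead_coeff_mult simp del: mult_pCons_left degree_root_poly)

lemma proots_root_poly [simp]: "proots (root_poly (M :: real multiset)) = M"
  by (induction M) (simp_all add: proots_mult del: mult_pCons_left)

lemma root_poly_inj: "root_poly (M :: real multiset) = root_poly N \<Longrightarrow> M = N"
  by (metis proots_root_poly)

text \<open>Each root above \<open>x\<close> contributes one negative factor.\<close>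

lemma sgn_poly_set_poly:
  assumes "finite S" "x \<notin> S"
  shows "0 < (- 1) ^ card {s \<in> S. x < s} * poly (set_poly S) x"
  using assms
proof (induction S)
  case (insert s S)
  have e: "poly (set_poly (insert s S)) x = (x - s) * poly (set_poly S) x"
    using insert by (simp add: algebra_simps)
  show ?case
  proof (cases "x < s")
    case True
    then have "{t \<in> insert s S. x < t} = insert s {t \<in> S. x < t}" by auto
    then have "card {t \<in> insert s S. x < t} = Suc (card {t \<in> S. x < t})"
      using insert by simp
    then have "(- 1) ^ card {t \<in> insert s S. x < t} * poly (set_poly (insert s S)) x
      = (s - x) * ((- 1) ^ card {t \<in> S. x < t} * poly (set_poly S) x)"
      unfolding e by (simp add: algebra_simps)
    then show ?thesis using insert True by simp
  next
    case False
    then have "{t \<in> insert s S. x < t} = {t \<in> S. x < t}" by auto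
    then have "(- 1) ^ card {t \<in> insert s S. x < t} * poly (set_poly (insert s S)) x
      = (x - s) * ((- 1) ^ card {t \<in> S. x < t} * poly (set_poly S) x)"
      unfolding e by (simp add: algebra_simps)
    then show ?thesis using insert False by simp
  qed
qed simp

text \<open>\<open>interlaces g Y\<close> says that \<open>g / set_poly Y\<close> is a sum of fractions \<open>c / (t - y)\<close>
  with \<open>c > 0\<close>.\<close>

definition interlaces :: "real poly \<Rightarrow> real set \<Rightarrow> bool" where
  "interlaces g Y \<longleftrightarrow>
     (\<exists>c. (\<forall>y\<in>Y. 0 < c y) \<and> g = (\<Sum>y\<in>Y. smult (c y) (set_poly (Y - {y}))))"

lemma poly_sum_partial_fractions:
  assumes "finite Y" "y \<in> Y"
  shows "poly (\<Sum>w\<in>Y. smult (c w) (set_poly (Y - {w}))) y = c y * poly (set_poly (Y - {y})) y"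
proof -
  have "poly (\<Sum>w\<in>Y. smult (c w) (set_poly (Y - {w}))) y
      = (\<Sum>w\<in>Y. c w * poly (set_poly (Y - {w})) y)" by (simp add: poly_sum)
  also have "\<dots> = (\<Sum>w\<in>Y. if w = y then c y * poly (set_poly (Y - {y})) y else 0)"
  proof (rule sum.cong)
    fix w assume "w \<in> Y"
    show "c w * poly (set_poly (Y - {w})) y = (if w = y then c y * poly (set_poly (Y - {y})) y else 0)"
      using assms by (auto simp: poly_set_poly_eq_0_iff)
  qed simp
  also have "\<dots> = c y * poly (set_poly (Y - {y})) y" using assms by simp
  finally show ?thesis .
qed

lemma degree_sum_partial_fractions:
  assumes "finite Y"
  shows "degree (\<Sum>w\<in>Y. smult (c w) (set_poly (Y - {w}))) \<le> card Y - 1"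
proof (rule degree_sum_le)
  fix w assume "w \<in> Y"
  then show "degree (smult (c w) (set_poly (Y - {w}))) \<le> card Y - 1"
    using assms by (intro order_trans[OF degree_smult_le]) simp
qed (use assms in simp)

text \<open>Lagrange interpolation on \<open>Y\<close>. The coefficient at \<open>y\<close> is
  positive because numerator and denominator have equally many roots above \<open>y\<close>, hence
  the same sign there.\<close>

lemma interlaces_set_polyI:
  assumes "finite Y" "finite Z" "card Y = Suc (card Z)" "Y \<inter> Z = {}"
    and "\<And>y. y \<in> Y \<Longrightarrow> card {z \<in> Z. y < z} = card {w \<in> Y. y < w}"
  shows "interlaces (set_poly Z) Y"
proof -
  define c where "c y = poly (set_poly Z) y / poly (set_poly (Y - {y})) y" for y
  have nz: "poly (set_poly (Y - {y})) y \<noteq> 0" for y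
    using assms(1) by (simp add: poly_set_poly_eq_0_iff)
  have pos: "0 < c y" if y: "y \<in> Y" for y
  proof -
    have "y \<notin> Z" using y assms(4) by auto
    then have 1: "0 < (- 1) ^ card {z \<in> Z. y < z} * poly (set_poly Z) y"
      by (rule sgn_poly_set_poly[OF assms(2)])
    have "{w \<in> Y - {y}. y < w} = {w \<in> Y. y < w}" by auto
    then have 2: "0 < (- 1) ^ card {z \<in> Z. y < z} * poly (set_poly (Y - {y})) y"
      using sgn_poly_set_poly[of "Y - {y}" y] assms(1,5) y by simp
    have "c y = ((- 1) ^ card {z \<in> Z. y < z} * poly (set_poly Z) y) /
       ((- 1) ^ card {z \<in> Z. y < z} * poly (set_poly (Y - {y})) y)"
      by (simp add: c_def)
    then show ?thesis using 1 2 by (simp only: divide_pos_pos)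
  qed
  have "set_poly Z = (\<Sum>y\<in>Y. smult (c y) (set_poly (Y - {y})))"
  proof (rule poly_eqI_degree[where A = Y])
    fix y assume "y \<in> Y"
    then show "poly (set_poly Z) y = poly (\<Sum>y\<in>Y. smult (c y) (set_poly (Y - {y}))) y"
      using nz assms(1) by (simp only: poly_sum_partial_fractions) (simp add: c_def)
  next
    show "card Y > degree (set_poly Z)" using assms by simp
    show "card Y > degree (\<Sum>y\<in>Y. smult (c y) (set_poly (Y - {y})))"
      using degree_sum_partial_fractions[OF assms(1), of c] assms(3) by linarith
  qed
  with pos show ?thesis unfolding interlaces_def by blast
qed

lemma poly_eventually_pos:
  fixes p :: "real poly"
  assumes "lead_coeff p > 0"
  shows "\<exists>x>b. 0 < poly p x"
proof -
  obtain n where "\<forall>x\<ge>n. poly p x \<ge> lead_coeff p" using poly_pinfty_gt_lc[OF assms] by blast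
  then have "poly p (max n (b + 1)) > 0" using assms by (meson less_le_trans max.cobounded1)
  then show ?thesis by (intro exI[of _ "max n (b + 1)"]) auto
qed

text \<open>Reflect by t -> -t and correct the leading sign to reduce to behaviour at plus
  infinity.\<close>

lemma poly_eventually_sgn_neg:
  fixes p :: "real poly"
  assumes "lead_coeff p > 0"
  shows "\<exists>x<b. 0 < (- 1) ^ degree p * poly p x"
proof -
  define q where "q = smult ((- 1) ^ degree p) (pcompose p [:0, - 1:])"
  have "lead_coeff q = lead_coeff p"
    using lead_coeff_comp[of "[:0, - 1 :: real:]" p]
    by (simp add: q_def lead_coeff_smult flip: power_mult_distrib)
  then obtain x where "x > - b" "0 < poly q x"
    using poly_eventually_pos[of q "- b"] assms by auto
  then show ?thesis
    by (intro exI[of _ "- x"]) (auto simp: q_def poly_pcompose)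
qed

text \<open>Divided by \<open>set_poly Z\<close>, the new polynomial is t - a minus positive
  multiples of 1 / (t - z). It therefore alternates in sign along \<open>Z\<close>, which forces one
  root in every gap, including the two unbounded ones.\<close>

lemma interlaces_step:
  assumes Z: "finite Z" and g: "interlaces g Z" and b: "0 < b"
  shows "\<exists>Y. finite Y \<and> card Y = Suc (card Z) \<and>
    [:- a, 1:] * set_poly Z - smult b g = set_poly Y \<and>
    interlaces (set_poly Z) Y \<and> dominated (mset_set Z) (mset_set Y)"
proof -
  define m where "m = card Z"
  define P where "P = [:- a, 1:] * set_poly Z - smult b g"
  obtain c where c: "\<And>z. z \<in> Z \<Longrightarrow> 0 < c z"
    and gc: "g = (\<Sum>y\<in>Z. smult (c y) (set_poly (Z - {y})))"
    using g unfolding interlaces_def by blast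
  have "degree ([:- a, 1:] * set_poly Z) = Suc m"
    using Z by (simp add: degree_mult_eq m_def del: mult_pCons_left)
  moreover have "degree (smult b g) < Suc m"
    using degree_sum_partial_fractions[OF Z, of c] degree_smult_le[of b g]
    unfolding gc m_def by linarith
  ultimately have degP: "degree P = Suc m" and lcP: "lead_coeff P = 1"
  proof -
    assume d: "degree ([:- a, 1:] * set_poly Z) = Suc m" "degree (smult b g) < Suc m"
    have "P = - smult b g + [:- a, 1:] * set_poly Z" by (simp add: P_def)
    then show "degree P = Suc m" using d by (simp only: degree_add_eq_right degree_minus)
    have "lead_coeff P = lead_coeff ([:- a, 1:] * set_poly Z)"
      unfolding P_def using d
      by (metis (no_types, lifting) \<open>P = - smult b g + [:- a, 1:] * set_poly Z\<close> P_def
          degree_minus lead_coeff_add_le)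
    then show "lead_coeff P = 1"
      by (simp only: lead_coeff_mult lead_coeff_root_poly) simp
  qed
  \<comment> \<open>\<open>U\<close> and \<open>L\<close> close the two outer gaps. Inserting 0
    keeps \<open>Max\<close> and \<open>Min\<close> meaningful for empty \<open>Z\<close> and gives
    \<open>L < U\<close>.\<close>
  obtain U where U: "U > Max (insert 0 Z)" "0 < poly P U"
    using poly_eventually_pos[of P] lcP by auto
  obtain L where L: "L < Min (insert 0 Z)" "0 < (- 1) ^ Suc m * poly P L"
    using poly_eventually_sgn_neg[of P] lcP degP by auto
  define zs where "zs = sorted_list_of_set Z"
  have zs: "length zs = m" "set zs = Z" "sorted_wrt (<) zs"
    using Z by (auto simp: zs_def m_def)
  \<comment> \<open>The points of \<open>Z\<close> in increasing order as
    \<open>p 1, ..., p m\<close>, with the sentinels \<open>L\<close> and \<open>U\<close> at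
    positions 0 and m + 1.\<close>
  define p where "p k = (if k = 0 then L else if k \<le> m then zs ! (k - 1) else U)" for k
  have pZ: "p ` {1..m} = Z"
  proof -
    have "p ` {1..m} = (\<lambda>k. zs ! k) ` {..<m}"
    proof -
      have "p ` {1..m} = p ` (Suc ` {..<m})" by (simp add: image_Suc_lessThan)
      also have "\<dots> = (\<lambda>k. zs ! k) ` {..<m}"
        unfolding image_image by (rule image_cong) (auto simp: p_def)
      finally show ?thesis .
    qed
    also have "\<dots> = Z" using zs by (auto simp: set_conv_nth)
    finally show ?thesis .
  qed
  have LZ: "L < z" "z < U" if "z \<in> Z" for z
    using L(1) U(1) Z that by auto
  have LU: "L < U" using L(1) U(1) Z by auto
  have mono: "p i < p j" if "i < j" "j \<le> Suc m" for i j
  proof -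
    have inZ: "p k \<in> Z" if "1 \<le> k" "k \<le> m" for k using that pZ by auto
    consider "i = 0" "j = Suc m" | "i = 0" "j \<noteq> Suc m" | "i \<noteq> 0" "j = Suc m"
      | "i \<noteq> 0" "j \<noteq> Suc m" by blast
    then show ?thesis
    proof cases
      case 1 then show ?thesis using LU by (simp add: p_def)
    next
      case 2 then show ?thesis using LZ(1)[OF inZ[of j]] that by (simp add: p_def)
    next
      case 3 then show ?thesis using LZ(2)[OF inZ[of i]] that by (simp add: p_def)
    next
      case 4
      then have "zs ! (i - 1) < zs ! (j - 1)"
        using that zs by (intro sorted_wrt_nth_less[OF zs(3)]) auto
      then show ?thesis using 4 that by (simp add: p_def)
    qed
  qed
  have mono_le: "p i \<le> p j" if "i \<le> j" "j \<le> Suc m" for i j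
    using mono[of i j] that by (cases "i = j") auto
  \<comment> \<open>The gap is closed on the left so that this serves both for a point of
    \<open>Z\<close> itself and for a root strictly inside the gap.\<close>
  have above: "card {z \<in> Z. x < z} = m - k"
    if x: "p k \<le> x" "x < p (Suc k)" and k: "k \<le> m" for x k
  proof -
    have "{z \<in> Z. x < z} = p ` {Suc k..m}"
    proof
      show "{z \<in> Z. x < z} \<subseteq> p ` {Suc k..m}"
      proof
        fix z assume z: "z \<in> {z \<in> Z. x < z}"
        then obtain l where l: "z = p l" "1 \<le> l" "l \<le> m" using pZ by auto
        have "\<not> l \<le> k"
          using mono_le[of l k] z l k x by auto
        then show "z \<in> p ` {Suc k..m}" using l by auto
      qed
      show "p ` {Suc k..m} \<subseteq> {z \<in> Z. x < z}"
      proof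
        fix z assume "z \<in> p ` {Suc k..m}"
        then obtain l where l: "z = p l" "Suc k \<le> l" "l \<le> m" by auto
        then have "p (Suc k) \<le> z" using mono_le[of "Suc k" l] by auto
        moreover have "z \<in> Z" using l pZ by auto
        ultimately show "z \<in> {z \<in> Z. x < z}" using x by auto
      qed
    qed
    moreover have "inj_on p {Suc k..m}"
    proof (rule inj_onI)
      fix i j assume "i \<in> {Suc k..m}" "j \<in> {Suc k..m}" "p i = p j"
      then show "i = j" using mono[of i j] mono[of j i] by (cases i j rule: linorder_cases) auto
    qed
    ultimately show ?thesis by (simp add: card_image)
  qed
  have sgn: "0 < (- 1) ^ (Suc m - k) * poly P (p k)" if k: "k \<le> Suc m" for k
  proof -
    consider "k = 0" | "k = Suc m" | "1 \<le> k" "k \<le> m" using k by linarith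
    then show ?thesis
    proof cases
      case 1 then show ?thesis using L by (simp add: p_def)
    next
      case 2 then show ?thesis using U by (simp add: p_def)
    next
      case 3
      then have pk: "p k \<in> Z" using pZ by auto
      \<comment> \<open>At a point of \<open>Z\<close> only \<open>g\<close> survives, and of
        \<open>g\<close> only the fraction with that pole. The minus sign before \<open>b\<close>
        supplies the extra exponent in \<open>Suc m - k\<close>.\<close>
      have "poly P (p k) = - (b * poly g (p k))"
        using Z pk by (simp add: P_def poly_set_poly_eq_0_iff)
      also have "poly g (p k) = c (p k) * poly (set_poly (Z - {p k})) (p k)"
        unfolding gc by (rule poly_sum_partial_fractions[OF Z pk])
      finally have e: "poly P (p k) = - (b * c (p k)) * poly (set_poly (Z - {p k})) (p k)" by simp
      have "{z \<in> Z - {p k}. p k < z} = {z \<in> Z. p k < z}" by auto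
      then have "0 < (- 1) ^ (m - k) * poly (set_poly (Z - {p k})) (p k)"
        using sgn_poly_set_poly[of "Z - {p k}" "p k"] Z above[of k "p k"] mono[of k "Suc k"] 3
        by simp
      moreover have "(- 1) ^ (Suc m - k) * poly P (p k)
          = (b * c (p k)) * ((- 1) ^ (m - k) * poly (set_poly (Z - {p k})) (p k))"
        unfolding e using 3 by (simp add: Suc_diff_le)
      ultimately show ?thesis using b c[OF pk] by simp
    qed
  qed
  have "\<forall>k\<in>{..m}. \<exists>y. p k < y \<and> y < p (Suc k) \<and> poly P y = 0"
  proof
    fix k assume "k \<in> {..m}"
    then have k: "k \<le> m" by simp
    have "0 < ((- 1) ^ (Suc m - k) * poly P (p k)) * ((- 1) ^ (Suc m - Suc k) * poly P (p (Suc k)))"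
      using k by (intro mult_pos_pos[OF sgn sgn]) auto
    also have "\<dots> = - (((- 1) ^ (m - k) * (- 1) ^ (m - k)) * (poly P (p k) * poly P (p (Suc k))))"
      using k by (simp add: Suc_diff_le algebra_simps)
    also have "(- 1 :: real) ^ (m - k) * (- 1) ^ (m - k) = 1"
      by (simp flip: power_mult_distrib)
    finally have "poly P (p k) * poly P (p (Suc k)) < 0" by simp
    then show "\<exists>y. p k < y \<and> y < p (Suc k) \<and> poly P y = 0"
      using poly_IVT[of "p k" "p (Suc k)" P] mono[of k "Suc k"] k by auto
  qed
  then obtain y where y: "\<And>k. k \<le> m \<Longrightarrow> p k < y k \<and> y k < p (Suc k) \<and> poly P (y k) = 0"
    by (auto simp: bchoice_iff)
  have ymono: "y i < y j" if "i < j" "j \<le> m" for i j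
    using y[of i] y[of j] mono_le[of "Suc i" j] that by fastforce
  have yinj: "inj_on y {..m}"
  proof (rule inj_onI)
    fix i j assume "i \<in> {..m}" "j \<in> {..m}" "y i = y j"
    then show "i = j" using ymono[of i j] ymono[of j i] by (cases i j rule: linorder_cases) auto
  qed
  define Y where "Y = y ` {..m}"
  have Y: "finite Y" "card Y = Suc m" using yinj by (simp_all add: Y_def card_image)
  \<comment> \<open>Both are monic of degree m + 1 and vanish at the m + 1 distinct points of
    \<open>Y\<close>.\<close>
  have PY: "P = set_poly Y"
  proof (rule poly_eqI_degree_lead_coeff[where n = "Suc m" and A = Y])
    show "poly.coeff P (Suc m) = poly.coeff (set_poly Y) (Suc m)"
      using lcP degP lead_coeff_root_poly[of "mset_set Y"] Y by simp
    fix z assume z: "z \<in> Y"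
    then have "poly P z = 0" using y by (auto simp: Y_def)
    then show "poly P z = poly (set_poly Y) z" using z Y by (simp add: poly_set_poly_eq_0_iff)
  qed (use degP Y in auto)
  have aboveY: "card {w \<in> Y. y k < w} = m - k" if k: "k \<le> m" for k
  proof -
    have "{w \<in> Y. y k < w} = y ` {Suc k..m}"
    proof
      show "{w \<in> Y. y k < w} \<subseteq> y ` {Suc k..m}"
      proof
        fix w assume w: "w \<in> {w \<in> Y. y k < w}"
        then obtain l where l: "w = y l" "l \<le> m" by (auto simp: Y_def)
        have "k < l" using w l ymono[of l k] k by (cases l k rule: linorder_cases) auto
        then show "w \<in> y ` {Suc k..m}" using l by auto
      qed
    qed (use ymono in \<open>auto simp: Y_def\<close>)
    moreover have "inj_on y {Suc k..m}" using yinj by (rule inj_on_subset) auto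
    ultimately show ?thesis by (simp add: card_image)
  qed
  have aboveZ: "card {z \<in> Z. y k < z} = m - k" if k: "k \<le> m" for k
    using above[of k "y k"] y[OF k] k by simp
  have disj: "Y \<inter> Z = {}"
  proof -
    have False if k: "k \<le> m" "y k \<in> Z" for k
    proof -
      have "y k \<in> p ` {1..m}" using k pZ by simp
      then obtain l where l: "y k = p l" "1 \<le> l" "l \<le> m" by auto
      show False using mono_le[of l k] mono_le[of "Suc k" l] y[OF k(1)] l k
        by (cases "l \<le> k") auto
    qed
    then show ?thesis by (auto simp: Y_def)
  qed
  have "interlaces (set_poly Z) Y"
    by (rule interlaces_set_polyI) (use Y Z disj aboveY aboveZ in \<open>auto simp: m_def Y_def\<close>)
  moreover have "dominated (mset_set Z) (mset_set Y)"
  \<comment> \<open>The k-th point of \<open>Z\<close> is sent to the root in the gap just above it;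
    the lowest root \<open>y 0\<close> is left out.\<close>
  proof (rule dominated_mset_setI[where f = "y \<circ> the_inv_into {1..m} p"])
    have pinj: "inj_on p {1..m}"
    proof (rule inj_onI)
      fix i j assume "i \<in> {1..m}" "j \<in> {1..m}" "p i = p j"
      then show "i = j" using mono[of i j] mono[of j i] by (cases i j rule: linorder_cases) auto
    qed
    have im: "the_inv_into {1..m} p ` Z = {1..m}" using pinj pZ by (metis the_inv_into_onto)
    show "inj_on (y \<circ> the_inv_into {1..m} p) Z"
    proof (rule comp_inj_on)
      show "inj_on (the_inv_into {1..m} p) Z" using pinj pZ inj_on_the_inv_into by metis
      show "inj_on y (the_inv_into {1..m} p ` Z)"
        unfolding im using yinj by (rule inj_on_subset) auto
    qed
    have "(y \<circ> the_inv_into {1..m} p) ` Z = y ` {1..m}" by (simp only: image_comp[symmetric] im)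
    then show "(y \<circ> the_inv_into {1..m} p) ` Z \<subseteq> Y" by (auto simp: Y_def)
    fix z assume "z \<in> Z"
    then obtain k where k: "z = p k" "k \<in> {1..m}" using pZ by auto
    then show "z \<le> (y \<circ> the_inv_into {1..m} p) z"
      using y[of k] pinj by (simp add: the_inv_into_f_f)
  qed (use Y Z in auto)
  ultimately show ?thesis using Y PY unfolding P_def m_def by blast
qed

section \<open>Merging two partial fraction sums\<close>

lemma mset_set_add_eq_Un_Int:
  assumes "finite A" "finite B"
  shows "mset_set A + mset_set B = mset_set (A \<union> B) + mset_set (A \<inter> B)"
  by (rule multiset_eqI) (use assms in \<open>auto simp: count_mset_set'\<close>)

lemma partial_fractions_superset:
  assumes "finite Z" "A \<subseteq> Z"
  shows "(\<Sum>y\<in>A. smult (c y) (set_poly (A - {y}))) * set_poly (Z - A)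
       = (\<Sum>z\<in>Z. smult (if z \<in> A then c z else 0) (set_poly (Z - {z})))"
proof -
  have fin: "finite A" using assms finite_subset by blast
  have "(\<Sum>z\<in>Z. smult (if z \<in> A then c z else 0) (set_poly (Z - {z})))
      = (\<Sum>z\<in>A. smult (c z) (set_poly (Z - {z})))"
    by (rule sum.mono_neutral_cong_right) (use assms in auto)
  also have "\<dots> = (\<Sum>z\<in>A. smult (c z) (set_poly (A - {z})) * set_poly (Z - A))"
  proof (rule sum.cong)
    fix z assume z: "z \<in> A"
    have "Z - {z} = (A - {z}) \<union> (Z - A)" using z assms by auto
    then have "mset_set (Z - {z}) = mset_set (A - {z}) + mset_set (Z - A)"
      by (simp only:) (rule mset_set_Union, use fin assms in auto)
    then show "smult (c z) (set_poly (Z - {z})) = smult (c z) (set_poly (A - {z})) * set_poly (Z - A)"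
      by simp
  qed simp
  finally show ?thesis by (simp add: sum_distrib_right)
qed

text \<open>Adding two fractions with positive residues gives simple poles on
  \<open>A \<union> B\<close>, with positive residues again. Since \<open>A\<close> and
  \<open>B\<close> may share points, clearing denominators leaves the common factor
  \<open>set_poly (A \<inter> B)\<close>.\<close>

lemma interlaces_merge:
  assumes A: "finite A" "interlaces g A" and B: "finite B" "interlaces h B"
    and pos: "0 < \<beta>" "0 < \<gamma>"
  obtains k where "interlaces k (A \<union> B)"
    "smult \<beta> g * set_poly B + smult \<gamma> h * set_poly A = k * set_poly (A \<inter> B)"
proof -
  obtain c where c: "\<forall>y\<in>A. 0 < c y" "g = (\<Sum>y\<in>A. smult (c y) (set_poly (A - {y})))"
    using A(2) unfolding interlaces_def by blast
  obtain e where e: "\<forall>y\<in>B. 0 < e y" "h = (\<Sum>y\<in>B. smult (e y) (set_poly (B - {y})))"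
    using B(2) unfolding interlaces_def by blast
  let ?Z = "A \<union> B"
  let ?c = "\<lambda>z. if z \<in> A then c z else 0" and ?e = "\<lambda>z. if z \<in> B then e z else 0"
  define k where "k = (\<Sum>z\<in>?Z. smult (\<beta> * ?c z + \<gamma> * ?e z) (set_poly (?Z - {z})))"
  have "interlaces k ?Z"
    unfolding interlaces_def k_def using c(1) e(1) pos
    by (intro exI[of _ "\<lambda>z. \<beta> * ?c z + \<gamma> * ?e z"]) (auto intro: add_pos_pos)
  moreover have "smult \<beta> g * set_poly B + smult \<gamma> h * set_poly A = k * set_poly (A \<inter> B)"
  proof -
    have 1: "set_poly B = set_poly (?Z - A) * set_poly (A \<inter> B)"
    proof -
      have "B = (?Z - A) \<union> (A \<inter> B)" "(?Z - A) \<inter> (A \<inter> B) = {}" by auto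
      then have "mset_set B = mset_set (?Z - A) + mset_set (A \<inter> B)"
        using A B by (metis finite_Diff finite_Int finite_Un mset_set_Union)
      then show ?thesis by (simp only: root_poly_simps)
    qed
    have 2: "set_poly A = set_poly (?Z - B) * set_poly (A \<inter> B)"
    proof -
      have "A = (?Z - B) \<union> (A \<inter> B)" "(?Z - B) \<inter> (A \<inter> B) = {}" by auto
      then have "mset_set A = mset_set (?Z - B) + mset_set (A \<inter> B)"
        using A B by (metis finite_Diff finite_Int finite_Un mset_set_Union)
      then show ?thesis by (simp only: root_poly_simps)
    qed
    have 3: "g * set_poly (?Z - A) = (\<Sum>z\<in>?Z. smult (?c z) (set_poly (?Z - {z})))"
      unfolding c(2) by (rule partial_fractions_superset) (use A B in auto)
    have 4: "h * set_poly (?Z - B) = (\<Sum>z\<in>?Z. smult (?e z) (set_poly (?Z - {z})))"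
      unfolding e(2) by (rule partial_fractions_superset) (use A B in auto)
    have "k = smult \<beta> (g * set_poly (?Z - A)) + smult \<gamma> (h * set_poly (?Z - B))"
      unfolding 3 4 k_def
      by (simp only: smult_add_left sum.distrib smult_smult[symmetric] smult_sum2)
    then show ?thesis by (subst 1, subst 2) (simp add: algebra_simps)
  qed
  ultimately show thesis using that by blast
qed

subsection \<open>Jacobi polynomials\<close>

text \<open>
  Characteristic polynomials of the leading blocks of a tridiagonal matrix with diagonal \<open>a\<close>,
  where \<open>b m\<close> is the product of the two off-diagonal entries joining sites \<open>m - 1\<close> and \<open>m\<close>.
  The index is shifted by one: \<open>jpoly a b (Suc m)\<close> belongs to the block of size \<open>m\<close>,
  so that the recursion needs no special first step and \<open>b 0\<close> is irrelevant.
\<close>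

fun jpoly :: "(nat \<Rightarrow> real) \<Rightarrow> (nat \<Rightarrow> real) \<Rightarrow> nat \<Rightarrow> real poly" where
  "jpoly a b 0 = 0"
| "jpoly a b (Suc 0) = 1"
| "jpoly a b (Suc (Suc m)) = [:- a m, 1:] * jpoly a b (Suc m) - smult (b m) (jpoly a b m)"

lemma jpoly_roots:
  assumes b: "\<And>m. 0 < b m"
  obtains Y where "\<And>m. finite (Y m)" "\<And>m. card (Y m) = m"
    "\<And>m. jpoly a b (Suc m) = set_poly (Y m)"
    "\<And>m. interlaces (jpoly a b m) (Y m)"
    "\<And>l m. l \<le> m \<Longrightarrow> dominated (mset_set (Y l)) (mset_set (Y m))"
proof -
  let ?P = "\<lambda>m Z. finite Z \<and> card Z = m \<and> jpoly a b (Suc m) = set_poly Z \<and> interlaces (jpoly a b m) Z"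
  have "\<exists>Y. \<forall>m. ?P m (Y m) \<and> dominated (mset_set (Y m)) (mset_set (Y (Suc m)))"
  proof (rule dependent_nat_choice)
    \<comment> \<open>The starting value \<open>jpoly a b 0 = 0\<close> is the empty sum of
      fractions.\<close>
    show "\<exists>Z. ?P 0 Z" by (intro exI[of _ "{}"]) (auto simp: interlaces_def)
  next
    fix Z m assume Z: "?P m Z"
    obtain Y where Y: "finite Y" "card Y = Suc (card Z)"
      "[:- a m, 1:] * set_poly Z - smult (b m) (jpoly a b m) = set_poly Y"
      "interlaces (set_poly Z) Y" "dominated (mset_set Z) (mset_set Y)"
      using interlaces_step[of Z "jpoly a b m" "b m" "a m"] Z b by blast
    have "jpoly a b (Suc (Suc m)) = set_poly Y"
      using Y(3) Z by (simp only: jpoly.simps)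
    then show "\<exists>Y. ?P (Suc m) Y \<and> dominated (mset_set Z) (mset_set Y)"
      using Y Z by (intro exI[of _ Y]) (auto simp del: jpoly.simps)
  qed
  then obtain Y where Y: "\<And>m. ?P m (Y m)"
    "\<And>m. dominated (mset_set (Y m)) (mset_set (Y (Suc m)))" by blast
  have "dominated (mset_set (Y l)) (mset_set (Y m))" if "l \<le> m" for l m
    using that by (induction rule: dec_induct) (auto intro: dominated_trans Y(2))
  with Y(1) show thesis by (intro that[of Y]) auto
qed

section \<open>Adjugate of t minus a tridiagonal matrix with upper entries \<open>u\<close> and
  lower entries \<open>w\<close>\<close>

locale jacobi =
  fixes n :: nat and a u w :: "nat \<Rightarrow> real"
  assumes u_pos: "\<And>l. Suc l < n \<Longrightarrow> 0 < u l" and w_pos: "\<And>l. Suc l < n \<Longrightarrow> 0 < w l"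
begin

text \<open>The value 1 off the matrix keeps \<open>b\<close> positive at every index, as
  \<open>jpoly_roots\<close> demands; at the two ends it meets \<open>jpoly a b 0\<close> or
  \<open>tail (Suc n)\<close>, both zero.\<close>

definition b :: "nat \<Rightarrow> real" where
  "b m = (if 0 < m \<and> m < n then u (m - 1) * w (m - 1) else 1)"

lemma b_pos: "0 < b m"
  by (auto simp: b_def intro!: mult_pos_pos u_pos w_pos)

definition head :: "nat \<Rightarrow> real poly" where
  "head i = jpoly a b (Suc i)"

text \<open>The matrix read from its last site: reversed site \<open>m\<close> is
  \<open>n - 1 - m\<close>, and the link below it is \<open>b (n - m)\<close>. \<open>tail j\<close>
  belongs to sites \<open>j\<close> to \<open>n - 1\<close>, so \<open>tail 0\<close> is the full
  characteristic polynomial.\<close>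

definition tail :: "nat \<Rightarrow> real poly" where
  "tail j = jpoly (\<lambda>m. a (n - 1 - m)) (\<lambda>m. b (n - m)) (Suc n - j)"

lemma head_0 [simp]: "head 0 = 1"
  by (simp add: head_def)

lemma head_Suc: "head (Suc i) = [:- a i, 1:] * head i - smult (b i) (jpoly a b i)"
  by (simp add: head_def)

lemma head_Suc':
  "head (Suc i) = [:- a i, 1:] * head i - (if i = 0 then 0 else smult (b i) (head (i - 1)))"
  by (cases i) (simp_all add: head_def)

lemma tail_n [simp]: "tail n = 1" and tail_Suc_n [simp]: "tail (Suc n) = 0"
  by (simp_all add: tail_def)

lemma tail_rec:
  assumes "j < n"
  shows "tail j = [:- a j, 1:] * tail (Suc j) - smult (b (Suc j)) (tail (Suc (Suc j)))"
proof -
  obtain m where m: "Suc n - j = Suc (Suc m)" using assms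
    by (metis Suc_diff_le Suc_diff_Suc less_imp_le)
  have "Suc n - Suc j = Suc m" "Suc n - Suc (Suc j) = m" "n - 1 - m = j" "n - m = Suc j"
    using m assms by auto
  then show ?thesis by (simp only: tail_def m jpoly.simps)
qed

text \<open>The characteristic polynomial split at the link between sites i - 1 and i. One step of
  each recursion moves the cut by one site without changing the value.\<close>

lemma two_sided_invariant:
  "i \<le> n \<Longrightarrow> head i * tail i - smult (b i) (jpoly a b i) * tail (Suc i) = tail 0"
proof (induction i)
  case 0
  then show ?case by simp
next
  case (Suc i)
  then have t: "tail i = [:- a i, 1:] * tail (Suc i) - smult (b (Suc i)) (tail (Suc (Suc i)))"
    by (intro tail_rec) simp
  have "head (Suc i) * tail (Suc i) - smult (b (Suc i)) (head i) * tail (Suc (Suc i))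
      = head i * tail i - smult (b i) (jpoly a b i) * tail (Suc i)"
    unfolding t head_Suc by (simp only: algebra_simps mult_smult_left mult_smult_right)
  then show ?case using Suc by (simp add: head_def)
qed

text \<open>Expansion of the determinant at site \<open>i\<close>. It compares the spectrum with
  that of the matrix with site \<open>i\<close> deleted, and gives the diagonal entries of the
  adjugate identity.\<close>

lemma two_sided_expansion:
  assumes "i < n"
  shows "tail 0 = [:- a i, 1:] * (head i * tail (Suc i))
     - (smult (b i) (jpoly a b i) * tail (Suc i) + smult (b (Suc i)) (tail (Suc (Suc i))) * head i)"
proof -
  have "tail 0 = head i * tail i - smult (b i) (jpoly a b i) * tail (Suc i)"
    using two_sided_invariant[of i] assms by simp
  then show ?thesis
    unfolding tail_rec[OF assms] by (simp only: algebra_simps mult_smult_left mult_smult_right)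
qed

text \<open>The product of the off-diagonal entries along the direct path from \<open>i\<close> to
  \<open>j\<close>.\<close>

definition coef :: "nat \<Rightarrow> nat \<Rightarrow> real" where
  "coef i j = (if i \<le> j then \<Prod>l=i..<j. u l else \<Prod>l=j..<i. w l)"

text \<open>The entries of the adjugate of \<open>t - G\<close>, as polynomials in \<open>t\<close>.\<close>

definition adj :: "nat \<Rightarrow> nat \<Rightarrow> real poly" where
  "adj i j = smult (coef i j) (head (min i j) * tail (Suc (max i j)))"

lemma coef_pos: "i < n \<Longrightarrow> j < n \<Longrightarrow> 0 < coef i j"
  unfolding coef_def
  by (auto intro!: linordered_semidom_class.prod_pos u_pos w_pos)

text \<open>Entry (i, j) of \<open>adj(t - G) (t - G) = \<chi>(t) I\<close>. Right of the diagonal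
  it is the recursion of \<open>tail\<close> at \<open>j\<close>, left of it the recursion of
  \<open>head\<close>, and on it the two-sided expansion.\<close>

lemma adj_eq:
  assumes "i < n" "j < n"
  shows "[:0, 1:] * adj i j
    - ((if 0 < j then smult (u (j - 1)) (adj i (j - 1)) else 0) + smult (a j) (adj i j)
       + (if Suc j < n then smult (w j) (adj i (Suc j)) else 0))
    = (if i = j then tail 0 else 0)"
proof -
  have x: "[:0, 1:] * p = [:- a j, 1:] * p + smult (a j) p" for p by simp
  consider "i < j" | "i = j" | "j < i" by linarith
  then show ?thesis
  proof cases
    case 1
    have c: "coef i j = coef i (j - 1) * u (j - 1)" "coef i (Suc j) = coef i j * u j"
      using 1 by (simp_all add: coef_def, metis Suc_pred gr_implies_not0 less_Suc_eq_le neq0_conv prod.atLeastLessThan_Suc)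
    have m: "min i (j - 1) = i" "max i (j - 1) = j - 1" "min i j = i" "max i j = j"
      "min i (Suc j) = i" "max i (Suc j) = Suc j" "Suc (j - 1) = j" using 1 by auto
    have A: "smult (u (j - 1)) (adj i (j - 1)) = smult (coef i j) (head i * tail j)"
      unfolding adj_def m c by (simp add: mult.commute)
    have B: "(if Suc j < n then smult (w j) (adj i (Suc j)) else 0)
        = smult (coef i j) (head i * smult (b (Suc j)) (tail (Suc (Suc j))))"
    proof (cases "Suc j < n")
      case True
      then show ?thesis unfolding adj_def m c by (simp add: b_def algebra_simps)
    next
      \<comment> \<open>At the last site the missing neighbour is matched by
        \<open>tail (Suc n) = 0\<close>.\<close>
      case False
      then have "Suc j = n" using assms by simp
      then show ?thesis by simp
    qed
    have C: "adj i j = smult (coef i j) (head i * tail (Suc j))" unfolding adj_def m ..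
    show ?thesis unfolding x A B unfolding C tail_rec[OF assms(2)] using 1
      by (simp add: algebra_simps smult_add_right smult_diff_right del: mult_pCons_left mult_pCons_right)
  next
    case 3
    have c: "coef i j = coef i (Suc j) * w j"
      using 3 by (auto simp: coef_def prod.atLeast_Suc_lessThan)
    have c': "0 < j \<Longrightarrow> coef i (j - 1) = coef i j * w (j - 1)"
      using 3 prod.atLeast_Suc_lessThan[of "j - 1" i w] by (auto simp: coef_def mult.commute)
    have m: "min i (j - 1) = j - 1" "max i (j - 1) = i" "min i j = j" "max i j = i"
      "min i (Suc j) = Suc j" "max i (Suc j) = i" using 3 by auto
    have A: "(if 0 < j then smult (u (j - 1)) (adj i (j - 1)) else 0)
       = smult (coef i j) ((if j = 0 then 0 else smult (b j) (head (j - 1))) * tail (Suc i))"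
      using assms c' unfolding adj_def m by (auto simp: b_def algebra_simps)
    have B: "(if Suc j < n then smult (w j) (adj i (Suc j)) else 0)
        = smult (coef i j) (head (Suc j) * tail (Suc i))"
      using 3 assms unfolding adj_def m c by (simp add: mult.commute)
    have C: "adj i j = smult (coef i j) (head j * tail (Suc i))" unfolding adj_def m ..
    show ?thesis unfolding x A B unfolding C head_Suc' using 3
      by (simp add: algebra_simps smult_add_right smult_diff_right del: mult_pCons_left mult_pCons_right)
  next
    case 2
    have A: "(if 0 < j then smult (u (j - 1)) (adj i (j - 1)) else 0)
       = smult (b j) (jpoly a b j) * tail (Suc j)"
    proof (cases j)
      case (Suc k)
      then show ?thesis using 2 assms
        by (simp add: adj_def coef_def b_def head_def algebra_simps del: jpoly.simps)
    qed simp
    have B: "(if Suc j < n then smult (w j) (adj i (Suc j)) else 0)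
       = smult (b (Suc j)) (tail (Suc (Suc j))) * head j"
    proof (cases "Suc j < n")
      case True
      then show ?thesis using 2 by (simp add: adj_def coef_def b_def algebra_simps)
    next
      case False
      then have "Suc j = n" using assms by simp
      then show ?thesis by simp
    qed
    have C: "adj i j = head j * tail (Suc j)" using 2 by (simp add: adj_def coef_def)
    show ?thesis unfolding x A B unfolding C two_sided_expansion[OF assms(2)] using 2
      by (simp add: algebra_simps del: mult_pCons_left mult_pCons_right)
  qed
qed

lemma adj_roots:
  obtains Y where "finite Y" "card Y = n" "tail 0 = set_poly Y"
    "\<And>i j. i < n \<Longrightarrow> j < n \<Longrightarrow> \<exists>M. adj i j = smult (coef i j) (root_poly M) \<and>
       (if i = j then Suc (size M) = n else Suc (size M) < n) \<and> dominated M (mset_set Y)"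
proof -
  obtain H where H: "\<And>m. finite (H m)" "\<And>m. card (H m) = m"
    "\<And>m. jpoly a b (Suc m) = set_poly (H m)" "\<And>m. interlaces (jpoly a b m) (H m)"
    "\<And>l m. l \<le> m \<Longrightarrow> dominated (mset_set (H l)) (mset_set (H m))"
    using jpoly_roots[of b a] b_pos by blast
  obtain T where T: "\<And>m. finite (T m)" "\<And>m. card (T m) = m"
    "\<And>m. jpoly (\<lambda>m. a (n - 1 - m)) (\<lambda>m. b (n - m)) (Suc m) = set_poly (T m)"
    "\<And>m. interlaces (jpoly (\<lambda>m. a (n - 1 - m)) (\<lambda>m. b (n - m)) m) (T m)"
    "\<And>l m. l \<le> m \<Longrightarrow> dominated (mset_set (T l)) (mset_set (T m))"
    using jpoly_roots[of "\<lambda>m. b (n - m)" "\<lambda>m. a (n - 1 - m)"] b_pos by blast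
  have tailT: "tail j = set_poly (T (n - j))" if "j \<le> n" for j
    using T(3)[of "n - j"] that by (simp add: tail_def Suc_diff_le)
  have headH: "head i = set_poly (H i)" for i by (simp add: head_def H(3))
  \<comment> \<open>Deleting site \<open>i\<close> lowers the spectrum. Roots common to both blocks
    remain roots of \<open>tail 0\<close> and are split off; what is left is one interlacing step on
    the union.\<close>
  have del: "dominated (mset_set (H i) + mset_set (T (n - Suc i))) (mset_set (T n))" if i: "i < n" for i
  proof -
    let ?A = "H i" and ?B = "T (n - Suc i)"
    have "interlaces (tail (Suc (Suc i))) ?B"
      using T(4)[of "n - Suc i"] i by (simp add: tail_def)
    then obtain k where k: "interlaces k (?A \<union> ?B)"
      "smult (b i) (jpoly a b i) * set_poly ?B + smult (b (Suc i)) (tail (Suc (Suc i))) * set_poly ?A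
        = k * set_poly (?A \<inter> ?B)"
      using interlaces_merge[OF H(1) H(4) T(1) _ b_pos b_pos] by blast
    obtain Y where Y: "finite Y" "[:- a i, 1:] * set_poly (?A \<union> ?B) - smult 1 k = set_poly Y"
      "dominated (mset_set (?A \<union> ?B)) (mset_set Y)"
      using interlaces_step[of "?A \<union> ?B" k 1 "a i"] k(1) H(1) T(1) by auto
    have e: "mset_set ?A + mset_set ?B = mset_set (?A \<union> ?B) + mset_set (?A \<inter> ?B)"
      by (rule mset_set_add_eq_Un_Int[OF H(1) T(1)])
    have "tail 0 = [:- a i, 1:] * (set_poly ?A * set_poly ?B) - k * set_poly (?A \<inter> ?B)"
      using two_sided_expansion[OF i] k(2) tailT[of "Suc i"] i by (simp only: headH Suc_leI)
    also have "set_poly ?A * set_poly ?B = set_poly (?A \<union> ?B) * set_poly (?A \<inter> ?B)"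
      using e by (metis root_poly_simps(3))
    finally have "tail 0 = ([:- a i, 1:] * set_poly (?A \<union> ?B) - smult 1 k) * set_poly (?A \<inter> ?B)"
      by (simp only: smult_1_left left_diff_distrib mult.assoc)
    then have "tail 0 = root_poly (mset_set Y + mset_set (?A \<inter> ?B))"
      by (simp only: Y(2) root_poly_simps)
    then have "root_poly (mset_set (T n)) = root_poly (mset_set Y + mset_set (?A \<inter> ?B))"
      using tailT[of 0] by simp
    then have "mset_set (T n) = mset_set Y + mset_set (?A \<inter> ?B)"
      by (rule root_poly_inj)
    then show ?thesis unfolding e using Y(3) by (simp add: dominated_add)
  qed
  show thesis
  proof (rule that[of "T n"])
    show "finite (T n)" "card (T n) = n" "tail 0 = set_poly (T n)" using T tailT[of 0] by auto
    fix i j assume ij: "i < n" "j < n"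
    let ?i = "min i j" and ?j = "max i j"
    let ?M = "mset_set (H ?i) + mset_set (T (n - Suc ?j))"
    have "adj i j = smult (coef i j) (root_poly ?M)"
      unfolding adj_def headH using tailT[of "Suc ?j"] ij by simp
    moreover have "if i = j then Suc (size ?M) = n else Suc (size ?M) < n"
    proof -
      have "size ?M = ?i + (n - Suc ?j)" using H T by simp
      moreover have "?j < n" using ij by simp
      moreover have "?i = ?j \<longleftrightarrow> i = j" "?i \<le> ?j" by (auto simp: min_def max_def)
      ultimately have "i = j \<Longrightarrow> Suc (size ?M) = n" "i \<noteq> j \<Longrightarrow> Suc (size ?M) < n"
        by linarith+
      then show ?thesis by simp
    qed
    moreover have "dominated ?M (mset_set (T n))"
    proof (rule dominated_trans)
      \<comment> \<open>Off the diagonal the tail block is only shorter, and shorter blocks are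
        dominated by longer ones.\<close>
      show "dominated ?M (mset_set (H ?i) + mset_set (T (n - Suc ?i)))"
        by (intro dominated_add T(5)) auto
      show "dominated (mset_set (H ?i) + mset_set (T (n - Suc ?i))) (mset_set (T n))"
        using ij by (intro del) auto
    qed
    ultimately show "\<exists>M. adj i j = smult (coef i j) (root_poly M) \<and>
       (if i = j then Suc (size M) = n else Suc (size M) < n) \<and> dominated M (mset_set (T n))"
      by blast
  qed
qed

end

subsection \<open>Birth-and-death chains\<close>

lemma sum_three_terms:
  fixes F :: "nat \<Rightarrow> 'b::comm_monoid_add"
  assumes "j < n" "\<And>l. l < n \<Longrightarrow> l + 1 < j \<or> j + 1 < l \<Longrightarrow> F l = 0"
  shows "(\<Sum>l<n. F l)
    = (if 0 < j then F (j - 1) else 0) + F j + (if Suc j < n then F (Suc j) else 0)"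
proof -
  let ?L = "if 0 < j then {j - 1} else {}" and ?R = "if Suc j < n then {Suc j} else {}"
  have "(\<Sum>l<n. F l) = (\<Sum>l\<in>?L \<union> ({j} \<union> ?R). F l)"
  proof (rule sum.mono_neutral_right)
    show "\<forall>l\<in>{..<n} - (?L \<union> ({j} \<union> ?R)). F l = 0"
    proof
      fix l assume l: "l \<in> {..<n} - (?L \<union> ({j} \<union> ?R))"
      then have "l \<noteq> j" "l \<noteq> Suc j" "Suc l \<noteq> j" "l < n" by (auto split: if_splits)
      then show "F l = 0" by (intro assms(2)) auto
    qed
  qed (use assms(1) in auto)
  also have "\<dots> = (\<Sum>l\<in>?L. F l) + ((\<Sum>l\<in>{j}. F l) + (\<Sum>l\<in>?R. F l))"
    by (subst sum.union_disjoint, simp, simp, force, subst sum.union_disjoint) auto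
  finally show ?thesis by (simp add: add.assoc)
qed

locale birth_death_chain =
  fixes d :: nat and G :: "real mat"
  assumes bd: "birth_death_generator d G" and irred: "irreducible_generator G"
begin

abbreviation "n \<equiv> Suc d"

lemma carrier: "G \<in> carrier_mat n n"
  using bd by (simp add: birth_death_generator_def generator_def)

lemma dim [simp]: "dim_row G = n" "dim_col G = n"
  using carrier by auto

lemma tridiag: "i < n \<Longrightarrow> j < n \<Longrightarrow> i + 1 < j \<or> j + 1 < i \<Longrightarrow> G $$ (i, j) = 0"
  using bd by (auto simp: birth_death_generator_def tridiagonal_def)

lemma row_sum: "i < n \<Longrightarrow> (\<Sum>j<n. G $$ (i, j)) = 0"
  using bd by (simp add: birth_death_generator_def generator_def)

text \<open>Were this rate zero, the states up to \<open>l\<close> could not be left, since jumps go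
  to neighbours only; this contradicts irreducibility.\<close>

lemma up_pos:
  assumes "Suc l < n"
  shows "0 < G $$ (l, Suc l)"
proof (rule ccontr)
  assume neg: "\<not> 0 < G $$ (l, Suc l)"
  let ?r = "{(i, j). i < dim_row G \<and> j < dim_row G \<and> i \<noteq> j \<and> 0 < G $$ (i, j)}"
  have step: "j \<le> l" if "(i, j) \<in> ?r" "i \<le> l" for i j
  proof (rule ccontr)
    assume "\<not> j \<le> l"
    moreover have "\<not> i + 1 < j" using tridiag[of i j] that(1) by auto
    ultimately have "i = l" "j = Suc l" using that(2) by auto
    then show False using neg that(1) by auto
  qed
  have "j \<le> l" if "(l, j) \<in> ?r\<^sup>*" for j
    using that by (induction rule: rtrancl_induct) (use step in blast)+
  moreover have "(l, Suc l) \<in> ?r\<^sup>*"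
    using irred assms unfolding irreducible_generator_def by auto
  ultimately show False by fastforce
qed

lemma down_pos:
  assumes "Suc l < n"
  shows "0 < G $$ (Suc l, l)"
proof (rule ccontr)
  assume neg: "\<not> 0 < G $$ (Suc l, l)"
  let ?r = "{(i, j). i < dim_row G \<and> j < dim_row G \<and> i \<noteq> j \<and> 0 < G $$ (i, j)}"
  have step: "Suc l \<le> j" if "(i, j) \<in> ?r" "Suc l \<le> i" for i j
  proof (rule ccontr)
    assume "\<not> Suc l \<le> j"
    moreover have "\<not> j + 1 < i" using tridiag[of i j] that(1) by auto
    ultimately have "i = Suc l" "j = l" using that(2) by auto
    then show False using neg that(1) by auto
  qed
  have "Suc l \<le> j" if "(Suc l, j) \<in> ?r\<^sup>*" for j
    using that by (induction rule: rtrancl_induct) (use step in blast)+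
  moreover have "(Suc l, l) \<in> ?r\<^sup>*"
    using irred assms unfolding irreducible_generator_def by auto
  ultimately show False by fastforce
qed

sublocale jacobi n "\<lambda>i. G $$ (i, i)" "\<lambda>l. G $$ (l, Suc l)" "\<lambda>l. G $$ (Suc l, l)"
  by unfold_locales (use up_pos down_pos in auto)

lemma column_sum:
  fixes F :: "nat \<Rightarrow> 'b::comm_monoid_add"
  assumes j: "j < n" and "\<And>l. l < n \<Longrightarrow> G $$ (l, j) = 0 \<Longrightarrow> F l = 0"
  shows "(\<Sum>l<n. F l)
    = (if 0 < j then F (j - 1) else 0) + F j + (if Suc j < n then F (Suc j) else 0)"
  using assms tridiag by (intro sum_three_terms) auto

lemma adj_mult:
  assumes "i < n" "j < n"
  shows "[:0, 1:] * adj i j - (\<Sum>l<n. smult (G $$ (l, j)) (adj i l))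
    = (if i = j then tail 0 else 0)"
proof -
  have "Suc (j - 1) = j" if "0 < j" using that by simp
  then have "(\<Sum>l<n. smult (G $$ (l, j)) (adj i l))
    = (if 0 < j then smult (G $$ (j - 1, Suc (j - 1))) (adj i (j - 1)) else 0)
      + smult (G $$ (j, j)) (adj i j)
      + (if Suc j < n then smult (G $$ (Suc j, j)) (adj i (Suc j)) else 0)"
    by (subst column_sum[OF assms(2)]) auto
  then show ?thesis using adj_eq[OF assms] by simp
qed

text \<open>If \<open>v\<close> vanishes up to \<open>k\<close>, column \<open>k\<close> of the
  equation leaves only the entry at k + 1, multiplied by a positive downward rate.\<close>

lemma left_kernel_zero:
  assumes ker: "\<And>j. j < n \<Longrightarrow> (\<Sum>l<n. v l * G $$ (l, j)) = 0" and v0: "v 0 = 0"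
  shows "j < n \<Longrightarrow> v j = 0"
proof (induction j rule: less_induct)
  case (less j)
  show ?case
  proof (cases j)
    case 0
    then show ?thesis using v0 by simp
  next
    case (Suc k)
    have "0 = (\<Sum>l<n. v l * G $$ (l, k))" using ker[of k] less.prems Suc by simp
    also have "\<dots> = v j * G $$ (j, k)"
      using less Suc by (subst column_sum[of k]) auto
    finally show ?thesis using down_pos[of k] less.prems Suc by simp
  qed
qed

lemma left_kernel_unique:
  assumes p: "\<And>j. j < n \<Longrightarrow> (\<Sum>l<n. p l * G $$ (l, j)) = 0" "(\<Sum>l<n. p l) = 1"
    and q: "\<And>j. j < n \<Longrightarrow> (\<Sum>l<n. q l * G $$ (l, j)) = 0" "(\<Sum>l<n. q l) = 1"
    and j: "j < n"
  shows "p j = q j"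
proof -
  \<comment> \<open>This combination lies in the left kernel and vanishes at state 0, hence
    everywhere; its total mass then gives \<open>p 0 = q 0\<close>.\<close>
  define v where "v l = q 0 * p l - p 0 * q l" for l
  have v: "v l = 0" if "l < n" for l
  proof (rule left_kernel_zero[OF _ _ that])
    fix j assume j: "j < n"
    have "(\<Sum>l<n. v l * G $$ (l, j))
      = q 0 * (\<Sum>l<n. p l * G $$ (l, j)) - p 0 * (\<Sum>l<n. q l * G $$ (l, j))"
      by (simp only: v_def left_diff_distrib sum_subtractf mult.assoc sum_distrib_left)
    then show "(\<Sum>l<n. v l * G $$ (l, j)) = 0" by (simp add: p q j del: sum.lessThan_Suc)
  qed (simp add: v_def)
  have "0 = (\<Sum>l<n. v l)" using v by simp
  also have "\<dots> = q 0 * (\<Sum>l<n. p l) - p 0 * (\<Sum>l<n. q l)"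
    by (simp only: v_def sum_subtractf sum_distrib_left)
  finally have eq: "p 0 = q 0" by (simp add: p q del: sum.lessThan_Suc)
  have "p 0 \<noteq> 0"
  proof
    assume "p 0 = 0"
    then have "(\<Sum>l<n. p l) = 0" using left_kernel_zero[OF p(1)] by simp
    then show False using p(2) by simp
  qed
  then show ?thesis using v[OF j] eq by (simp add: v_def)
qed

text \<open>At a root of \<open>tail 0\<close> the adjugate identity makes row 0 of the adjugate a
  left eigenvector of \<open>G\<close>.\<close>

lemma tail_root_eigenvalue:
  assumes "poly (tail 0) y = 0"
  shows "poly (char_poly (- G)) (- y) = 0"
proof -
  define A where "A = transpose_mat (- G)"
  have A: "A \<in> carrier_mat n n" using carrier by (simp add: A_def)
  define v where "v = vec n (\<lambda>j. poly (adj 0 j) y)"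
  \<comment> \<open>In the last entry both polynomial factors are 1, leaving a positive path
    product.\<close>
  have "v $ d \<noteq> 0"
    using coef_pos[of 0 d] by (simp add: v_def adj_def)
  then have "v \<noteq> 0\<^sub>v n" by auto
  moreover have "A *\<^sub>v v = (- y) \<cdot>\<^sub>v v"
  proof (rule eq_vecI)
    fix j assume "j < dim_vec ((- y) \<cdot>\<^sub>v v)"
    then have j: "j < n" by (simp add: v_def)
    have "poly ([:0, 1:] * adj 0 j - (\<Sum>l<n. smult (G $$ (l, j)) (adj 0 l))) y = 0"
      using adj_mult[of 0 j] j assms by simp
    then have e: "y * poly (adj 0 j) y = (\<Sum>l<n. G $$ (l, j) * poly (adj 0 l) y)"
      by (simp add: poly_sum)
    have "(A *\<^sub>v v) $ j = (\<Sum>l<n. - G $$ (l, j) * poly (adj 0 l) y)"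
      using j by (simp add: A_def v_def scalar_prod_def atLeast0LessThan del: sum.lessThan_Suc)
    also have "\<dots> = - (y * poly (adj 0 j) y)"
      unfolding e by (simp add: sum_negf del: sum.lessThan_Suc)
    finally show "(A *\<^sub>v v) $ j = ((- y) \<cdot>\<^sub>v v) $ j" using j by (simp add: v_def)
  qed (simp add: A_def v_def)
  ultimately have "eigenvalue A (- y)"
    unfolding eigenvalue_def eigenvector_def using A by (intro exI[of _ v]) (auto simp: v_def)
  then show ?thesis
    using eigenvalue_root_char_poly[OF A] carrier by (simp add: A_def)
qed

end

section \<open>Newton expansion along the spectrum\<close>

locale birth_death_spectrum = birth_death_chain +
  fixes \<nu> :: "nat \<Rightarrow> real"
  assumes ev: "eigenvalues_with_mult (Suc d) (- G) \<nu>"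
    and decr: "\<And>i j. i \<le> j \<Longrightarrow> j \<le> d \<Longrightarrow> \<nu> j \<le> \<nu> i"
begin

text \<open>The eigenvalues \<open>- \<nu> d, ..., - \<nu> k\<close> of \<open>G\<close>, largest
  first: \<open>nodes 0\<close> is the whole spectrum and \<open>nodes n\<close> is empty.\<close>

definition nodes :: "nat \<Rightarrow> real list" where
  "nodes k = map (\<lambda>l. - \<nu> l) (rev [k..<n])"

lemma nodes_snoc: "k < n \<Longrightarrow> nodes k = nodes (Suc k) @ [- \<nu> k]"
  unfolding nodes_def by (subst upt_conv_Cons) auto

lemma nodes_append: "k \<le> n \<Longrightarrow> nodes 0 = nodes k @ map (\<lambda>l. - \<nu> l) (rev [0..<k])"
  unfolding nodes_def using upt_add_eq_append[of 0 k "n - k"]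
  by (simp flip: map_append rev_append del: upt_Suc)

lemma sorted_nodes: "sorted_wrt (\<ge>) (nodes 0)"
  unfolding nodes_def using decr
  by (auto simp: sorted_wrt_iff_nth_less rev_nth simp del: upt_Suc)

text \<open>The n distinct roots of \<open>tail 0\<close> all occur among the n numbers
  \<open>- \<nu> l\<close>. Counting forces equality, and with it that the spectrum is
  simple.\<close>

lemma mset_nodes:
  assumes Y: "finite Y" "card Y = n" "tail 0 = set_poly Y"
  shows "mset (nodes 0) = mset_set Y"
proof -
  let ?f = "\<lambda>l. - \<nu> l"
  have sub: "Y \<subseteq> ?f ` {..<n}"
  proof
    fix y assume "y \<in> Y"
    then have "poly (tail 0) y = 0" using Y by (simp add: poly_set_poly_eq_0_iff)
    then have "poly (\<Prod>i<n. [:- \<nu> i, 1:]) (- y) = 0"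
      using tail_root_eigenvalue ev by (simp add: eigenvalues_with_mult_def)
    then obtain i where "i < n" "- y - \<nu> i = 0"
      by (auto simp: poly_prod simp del: prod.lessThan_Suc)
    then show "y \<in> ?f ` {..<n}" by (intro image_eqI[of _ _ i]) auto
  qed
  have le: "card (?f ` {..<n}) \<le> n" using card_image_le[of "{..<n}" ?f] by simp
  have eq: "Y = ?f ` {..<n}"
    using le Y by (intro card_seteq[OF _ sub]) auto
  then have inj: "inj_on ?f {..<n}" using Y(2) by (intro eq_card_imp_inj_on) auto
  have "mset (nodes 0) = image_mset ?f (mset_set {..<n})"
    unfolding nodes_def by (simp only: mset_map mset_rev mset_upt atLeast0LessThan)
  also have "\<dots> = mset_set Y" unfolding eq by (rule image_mset_mset_set[OF inj])
  finally show ?thesis .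
qed

lemma adj_root_poly:
  assumes "i < n" "j < n"
  obtains M where "adj i j = smult (coef i j) (root_poly M)"
    "if i = j then Suc (size M) = n else Suc (size M) < n" "dominated M (mset (nodes 0))"
proof (rule adj_roots)
  fix Y
  assume Y: "finite Y" "card Y = n" "tail 0 = set_poly Y"
    and adj: "\<And>i j. i < n \<Longrightarrow> j < n \<Longrightarrow> \<exists>M. adj i j = smult (coef i j) (root_poly M) \<and>
       (if i = j then Suc (size M) = n else Suc (size M) < n) \<and> dominated M (mset_set Y)"
  from adj[OF assms] obtain M where "adj i j = smult (coef i j) (root_poly M)"
    "if i = j then Suc (size M) = n else Suc (size M) < n" "dominated M (mset_set Y)"
    by blast
  then show thesis by (intro that) (simp_all only: mset_nodes[OF Y])
qed

lemma tail_0_nodes: "tail 0 = root_poly (mset (nodes 0))"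
proof (rule adj_roots)
  fix Y
  assume Y: "finite Y" "card Y = n" "tail 0 = set_poly Y"
  then show ?thesis by (simp only: mset_nodes[OF Y])
qed

lemma shifted_prod_carrier: "shifted_prod G \<nu> k \<in> carrier_mat n n"
proof (induction k)
  case (Suc k)
  have "G + \<nu> k \<cdot>\<^sub>m 1\<^sub>m n \<in> carrier_mat n n" by (rule carrier_matI) simp_all
  with Suc show ?case by (simp only: shifted_prod.simps dim mult_carrier_mat)
qed simp

lemma shifted_prod_Suc_entry:
  assumes "i < n" "j < n"
  shows "shifted_prod G \<nu> (Suc k) $$ (i, j)
    = (\<Sum>l<n. shifted_prod G \<nu> k $$ (i, l) * G $$ (l, j)) + \<nu> k * shifted_prod G \<nu> k $$ (i, j)"
proof -
  let ?S = "shifted_prod G \<nu> k"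
  have S: "?S \<in> carrier_mat n n" by (rule shifted_prod_carrier)
  have "shifted_prod G \<nu> (Suc k) $$ (i, j)
      = (\<Sum>l<n. ?S $$ (i, l) * (G $$ (l, j) + \<nu> k * (if l = j then 1 else 0)))"
    using assms S by (simp add: scalar_prod_def atLeast0LessThan del: sum.lessThan_Suc)
  also have "\<dots> = (\<Sum>l<n. ?S $$ (i, l) * G $$ (l, j))
      + (\<Sum>l<n. if l = j then \<nu> k * ?S $$ (i, l) else 0)"
    unfolding sum.distrib[symmetric] by (rule sum.cong) (auto simp: algebra_simps)
  also have "(\<Sum>l<n. if l = j then \<nu> k * ?S $$ (i, l) else 0) = \<nu> k * ?S $$ (i, j)"
    using assms by (subst sum.delta) auto
  finally show ?thesis .
qed

lemma shifted_prod_div_diff: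
  "k \<le> n \<Longrightarrow> shifted_prod G \<nu> k = mat n n (\<lambda>(i, j). div_diff (adj i j) (nodes k))"
proof (induction k)
  case 0
  show ?case
  proof (rule eq_matI)
    fix i j assume "i < dim_row (mat n n (\<lambda>(i, j). div_diff (adj i j) (nodes 0)))"
      "j < dim_col (mat n n (\<lambda>(i, j). div_diff (adj i j) (nodes 0)))"
    then have ij: "i < n" "j < n" by auto
    obtain M where M: "adj i j = smult (coef i j) (root_poly M)"
      "if i = j then Suc (size M) = n else Suc (size M) < n"
      using adj_root_poly[OF ij] by blast
    have len: "length (nodes 0) = n" by (simp add: nodes_def del: upt_Suc)
    \<comment> \<open>On n nodes the divided difference reads off the coefficient of degree n - 1,
      which gives the identity matrix.\<close>
    have "div_diff (root_poly M) (nodes 0) = (if i = j then 1 else 0)"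
      using M(2) len by (subst div_diff_root_poly_degree) (auto split: if_splits)
    then show "shifted_prod G \<nu> 0 $$ (i, j) = mat n n (\<lambda>(i, j). div_diff (adj i j) (nodes 0)) $$ (i, j)"
      using ij M(1) by (simp add: div_diff_smult coef_def)
  qed auto
next
  case (Suc k)
  then have IH: "shifted_prod G \<nu> k = mat n n (\<lambda>(i, j). div_diff (adj i j) (nodes k))" by simp
  have k: "k < n" using Suc.prems by simp
  show ?case
  proof (rule eq_matI)
    fix i j assume "i < dim_row (mat n n (\<lambda>(i, j). div_diff (adj i j) (nodes (Suc k))))"
      "j < dim_col (mat n n (\<lambda>(i, j). div_diff (adj i j) (nodes (Suc k))))"
    then have ij: "i < n" "j < n" by auto
    \<comment> \<open>All nodes are roots of \<open>tail 0\<close>, so the right side of the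
      adjugate identity drops out. The Leibniz rule at the last node \<open>- \<nu> k\<close> then
      yields the factor \<open>G + \<nu> k\<close>.\<close>
    have "div_diff (tail 0) (nodes k) = 0"
      unfolding tail_0_nodes nodes_append[OF less_imp_le[OF k]] by (rule div_diff_root_poly_self)
    then have "div_diff ([:0, 1:] * adj i j) (nodes k)
        = (\<Sum>l<n. G $$ (l, j) * div_diff (adj i l) (nodes k))"
      using arg_cong[OF adj_mult[OF ij], of "\<lambda>p. div_diff p (nodes k)"]
      by (simp add: div_diff_diff div_diff_sum div_diff_smult
          del: sum.lessThan_Suc mult_pCons_left split: if_splits)
    moreover have "div_diff ([:0, 1:] * adj i j) (nodes k)
        = - \<nu> k * div_diff (adj i j) (nodes k) + div_diff (adj i j) (nodes (Suc k))"
      using div_diff_linear_mult_snoc[of 0 "adj i j" "nodes (Suc k)" "- \<nu> k"]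
      by (simp only: nodes_snoc[OF k] minus_zero diff_0_right)
    ultimately have e: "div_diff (adj i j) (nodes (Suc k))
        = (\<Sum>l<n. G $$ (l, j) * div_diff (adj i l) (nodes k)) + \<nu> k * div_diff (adj i j) (nodes k)"
      by simp
    have "shifted_prod G \<nu> (Suc k) $$ (i, j)
      = (\<Sum>l<n. G $$ (l, j) * div_diff (adj i l) (nodes k)) + \<nu> k * div_diff (adj i j) (nodes k)"
      unfolding shifted_prod_Suc_entry[OF ij] IH using ij
      by (simp add: mult.commute del: sum.lessThan_Suc)
    then show "shifted_prod G \<nu> (Suc k) $$ (i, j)
      = mat n n (\<lambda>(i, j). div_diff (adj i j) (nodes (Suc k))) $$ (i, j)"
      using ij e by simp
  qed (auto simp: IH)
qed

lemma shifted_prod_nonneg: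
  assumes "k \<le> n" "i < n" "j < n"
  shows "0 \<le> shifted_prod G \<nu> k $$ (i, j)"
proof -
  obtain M where M: "adj i j = smult (coef i j) (root_poly M)" "dominated M (mset (nodes 0))"
    using adj_root_poly[OF assms(2,3)] by blast
  \<comment> \<open>Domination is by the whole spectrum, of which \<open>nodes k\<close> is the top
    segment.\<close>
  have "0 \<le> div_diff (root_poly M) (nodes k)"
    using sorted_nodes M(2) unfolding nodes_append[OF assms(1)]
    by (rule div_diff_root_poly_nonneg)
  then show ?thesis
    using assms coef_pos[OF assms(2,3)] by (simp add: shifted_prod_div_diff M(1) div_diff_smult)
qed

text \<open>Rows of \<open>G\<close> sum to zero, so each factor \<open>G + \<nu> k\<close>
  multiplies row sums by \<open>\<nu> k\<close>.\<close>

lemma shifted_prod_row_sum: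
  "k \<le> n \<Longrightarrow> i < n \<Longrightarrow> (\<Sum>j<n. shifted_prod G \<nu> k $$ (i, j)) = (\<Prod>l<k. \<nu> l)"
proof (induction k)
  case 0
  have "(\<Sum>j<n. shifted_prod G \<nu> 0 $$ (i, j)) = (\<Sum>j<n. if j = i then 1 else 0)"
    using 0 by (intro sum.cong) auto
  then show ?case using 0 by (subst (asm) sum.delta) auto
next
  case (Suc k)
  let ?S = "shifted_prod G \<nu> k"
  have "(\<Sum>j<n. shifted_prod G \<nu> (Suc k) $$ (i, j))
      = (\<Sum>j<n. \<Sum>l<n. ?S $$ (i, l) * G $$ (l, j)) + \<nu> k * (\<Sum>j<n. ?S $$ (i, j))"
    unfolding sum_distrib_left sum.distrib[symmetric]
    using Suc.prems by (intro sum.cong shifted_prod_Suc_entry) auto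
  also have "(\<Sum>j<n. \<Sum>l<n. ?S $$ (i, l) * G $$ (l, j)) = (\<Sum>l<n. ?S $$ (i, l) * (\<Sum>j<n. G $$ (l, j)))"
    unfolding sum_distrib_left by (rule sum.swap)
  also have "\<dots> = 0" using row_sum by (intro sum.neutral) auto
  also have "(\<Sum>j<n. ?S $$ (i, j)) = (\<Prod>l<k. \<nu> l)" using Suc by simp
  finally show ?case by simp
qed

text \<open>With no nodes left the full product is zero (Cayley-Hamilton), and its last factor is
  \<open>G\<close> itself because \<open>\<nu> d = 0\<close>.\<close>

lemma shifted_prod_stationary:
  assumes "\<nu> d = 0" "i < n" "j < n"
  shows "(\<Sum>l<n. shifted_prod G \<nu> d $$ (i, l) * G $$ (l, j)) = 0"
proof -
  have "shifted_prod G \<nu> (Suc d) $$ (i, j) = 0"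
    using shifted_prod_div_diff[of "Suc d"] assms by (simp add: nodes_def del: shifted_prod.simps)
  then show ?thesis using shifted_prod_Suc_entry[of i j d] assms by simp
qed

end

theorem lemma5p2:
  fixes d :: nat and G :: "real mat" and \<pi> :: "real vec" and \<nu> :: "nat \<Rightarrow> real"
  assumes "birth_death_generator d G"
    and "irreducible_generator G"
    and "stationary_pmf G \<pi>"
    and "eigenvalues_with_mult (Suc d) (- G) \<nu>"
    and "\<And>i j. i \<le> j \<Longrightarrow> j \<le> d \<Longrightarrow> \<nu> j \<le> \<nu> i"
    and "0 < d \<Longrightarrow> \<nu> (d - 1) > \<nu> d"
    and "\<nu> d = 0"
  shows "(\<forall>k\<le>d. stochastic_mat (Suc d) (Q_mat G \<nu> k)) \<and>
         (\<forall>i\<le>d. row (Q_mat G \<nu> d) i = \<pi>)"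
proof -
  interpret birth_death_spectrum d G \<nu>
    using assms by unfold_locales auto
  \<comment> \<open>The strict gap at d - 1 and monotonicity make all inverted eigenvalues positive,
    so \<open>inverse\<close> never meets its default value at 0.\<close>
  have pos: "0 < \<nu> l" if "l < d" for l
    using assms(5)[of l "d - 1"] assms(6,7) that by fastforce
  let ?c = "\<lambda>k. \<Prod>l<k. inverse (\<nu> l)"
  have c: "0 < ?c k" "?c k * (\<Prod>l<k. \<nu> l) = 1" if "k \<le> d" for k
  proof -
    show "0 < ?c k" using pos that by (intro linordered_semidom_class.prod_pos) auto
    show "?c k * (\<Prod>l<k. \<nu> l) = 1"
      unfolding prod.distrib[symmetric]
    proof (intro prod.neutral ballI)
      fix l assume "l \<in> {..<k}"
      then have "\<nu> l \<noteq> 0" using pos[of l] that by simp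
      then show "inverse (\<nu> l) * \<nu> l = 1" by simp
    qed
  qed
  have entry: "Q_mat G \<nu> k $$ (i, j) = ?c k * shifted_prod G \<nu> k $$ (i, j)"
    if "k \<le> d" "i < n" "j < n" for k i j
    using that shifted_prod_carrier[of k] by (simp add: Q_mat_def)
  have carrierQ: "Q_mat G \<nu> k \<in> carrier_mat n n" if "k \<le> d" for k
    using that shifted_prod_carrier[of k] by (simp add: Q_mat_def)
  have sumQ: "(\<Sum>j<n. Q_mat G \<nu> k $$ (i, j)) = 1" if "k \<le> d" "i < n" for k i
  proof -
    have "(\<Sum>j<n. Q_mat G \<nu> k $$ (i, j)) = ?c k * (\<Sum>j<n. shifted_prod G \<nu> k $$ (i, j))"
      unfolding sum_distrib_left using that entry by (intro sum.cong) auto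
    then show ?thesis using that c shifted_prod_row_sum[of k i] by simp
  qed
  have "stochastic_mat n (Q_mat G \<nu> k)" if k: "k \<le> d" for k
    unfolding stochastic_mat_def
    using carrierQ[OF k] sumQ[OF k] entry[OF k] shifted_prod_nonneg[of k] c(1)[OF k] k
    by (auto simp del: sum.lessThan_Suc)
  moreover have "row (Q_mat G \<nu> d) i = \<pi>" if i: "i \<le> d" for i
  proof (rule eq_vecI)
    have dimpi: "dim_vec \<pi> = n" and sumpi: "(\<Sum>l<n. \<pi> $ l) = 1"
      and pi0: "transpose_mat G *\<^sub>v \<pi> = 0\<^sub>v n"
      using assms(3) by (auto simp: stationary_pmf_def pmf_vec_def)
    show "dim_vec (row (Q_mat G \<nu> d) i) = dim_vec \<pi>" using carrierQ[of d] dimpi by simp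
    fix j assume "j < dim_vec \<pi>"
    then have j: "j < n" using dimpi by simp
    have "Q_mat G \<nu> d $$ (i, j) = \<pi> $ j"
    \<comment> \<open>Row \<open>i\<close> of \<open>Q_mat G \<nu> d\<close> and
      \<open>\<pi>\<close> are both left null vectors of \<open>G\<close> with entries summing to
      1.\<close>
    proof (rule left_kernel_unique[OF _ _ _ _ j])
      fix j assume j: "j < n"
      have "(\<Sum>l<n. Q_mat G \<nu> d $$ (i, l) * G $$ (l, j))
          = ?c d * (\<Sum>l<n. shifted_prod G \<nu> d $$ (i, l) * G $$ (l, j))"
        unfolding sum_distrib_left using i entry by (intro sum.cong) auto
      then show "(\<Sum>l<n. Q_mat G \<nu> d $$ (i, l) * G $$ (l, j)) = 0"
        using shifted_prod_stationary[of i j] assms(7) i j by simp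
      have "(transpose_mat G *\<^sub>v \<pi>) $ j = (\<Sum>l<n. \<pi> $ l * G $$ (l, j))"
        using j dimpi
        by (simp add: scalar_prod_def atLeast0LessThan mult.commute del: sum.lessThan_Suc)
      then show "(\<Sum>l<n. \<pi> $ l * G $$ (l, j)) = 0" using pi0 j by simp
    qed (use sumQ[of d i] i sumpi in auto)
    then show "row (Q_mat G \<nu> d) i $ j = \<pi> $ j" using carrierQ[of d] i j by simp
  qed
  ultimately show ?thesis by blast
qed

end
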